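(* Let $G$ be a semisimple compact Lie group, identified with its image under a faithful orthogonal matrix representation, with Cartan decomposition $\mathfrak{g}=\mathfrak{t}\oplus\mathfrak{p}$ of its Lie algebra, let $K\subset G$ be the Lie subgroup corresponding to $\mathfrak{t}$, let $G_0=K\ltimes \mathfrak{p}$ be the associated Cartan motion group, and for $\lambda\ge 1$ let $\Psi_\lambda\colon G_0\to G$, $\Psi_\lambda(k,v)=\exp(v/\lambda)k$. Then the maps $\Psi_\lambda$ are approximated homomorphisms, in the following sense: (i) $\Psi_\lambda(g^{-1})=(\Psi_\lambda(g))^{-1}$ for all $g\in G_0$; (ii) for all $g_1=(k_1,v_1),\,g_2=(k_2,v_2)\in G_0$ there is a constant $C=C(g_1,g_2)$, independent of $\lambda$, such that for every $\lambda\ge 1$ large enough that $\|v_1\|+\|v_2\|\le \lambda r$ with $r=0.59$, $$\|\Psi_\lambda(g_1g_2)-\Psi_\lambda(g_1)\Psi_\lambda(g_2)\|_F\le \frac{C}{\lambda^2}.$$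
   Context: Setting. $G$ is a semisimple compact Lie group whose elements are identified with orthogonal matrices via a faithful orthogonal representation; correspondingly its (real) Lie algebra $\mathfrak{g}$ is identified with a space of skew-symmetric matrices. A Cartan decomposition $\mathfrak{g}=\mathfrak{t}\oplus\mathfrak{p}$ is the decomposition into the $+1$ eigenspace $\mathfrak{t}$ and $-1$ eigenspace $\mathfrak{p}$ of an involutive automorphism (Cartan involution) of $\mathfrak{g}$, so $[\mathfrak{t},\mathfrak{t}]\subset\mathfrak{t}$, $[\mathfrak{t},\mathfrak{p}]\subset\mathfrak{p}$, $[\mathfrak{p},\mathfrak{p}]\subset\mathfrak{t}$. $K$ is the Lie subgroup of $G$ with Lie algebra $\mathfrak{t}$; $\mathfrak p$ is closed under $\mathrm{Ad}_k(v)=kvk^{-1}$ for $k\in K$. The Cartan motion group is $G_0=K\ltimes V$ with $V=\mathfrak{p}$ and product $$(k_1,v_1)(k_2,v_2)=(k_1k_2,\;v_1+\mathrm{Ad}_{k_1}(v_2)).$$ The map $\exp$ is the Lie group exponential of $G$ (matrix exponential), $\|\cdot\|_F$ is the Frobenius norm, and $\|v\|$ for $v\in\mathfrak p$ is the (Frobenius) norm of the matrix $v$. *)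

theory Defs
  imports "HOL-Analysis.Analysis" "HOL-Algebra.Group"
begin

text \<open>
  The default norm on \<^typ>\<open>real^'n^'n\<close> is the Euclidean norm of the vector of row norms, i.e. the
  Frobenius norm:
\<close>

lemma norm_matrix_eq_Frobenius:
  fixes A :: "real^'n^'n"
  shows "norm A = sqrt (\<Sum>i\<in>UNIV. \<Sum>j\<in>UNIV. (A $ i $ j)\<^sup>2)"
  by (simp add: norm_vec_def L2_set_def sum_nonneg)

text \<open>
  The library's \<^const>\<open>exp\<close> is not available here, because the multiplication \<open>*\<close> on
  \<^typ>\<open>real^'n^'n\<close> is componentwise.
\<close>

definition matrix_exp :: "real^'n^'n \<Rightarrow> real^'n^'n" where
  "matrix_exp A = (\<Sum>k. (1 / fact k) *\<^sub>R (((**) A ^^ k) (mat 1)))"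

definition orthogonal_group :: "(real^'n^'n) monoid" where
  "orthogonal_group =
     \<lparr>carrier = {A. orthogonal_matrix A}, mult = (**), one = mat 1\<rparr>"

text \<open>The Lie algebra of a closed subgroup of the orthogonal group.\<close>

definition lie_algebra :: "(real^'n^'n) set \<Rightarrow> (real^'n^'n) set" where
  "lie_algebra G = {X. \<forall>s::real. matrix_exp (s *\<^sub>R X) \<in> G}"

definition commutator :: "real^'n^'n \<Rightarrow> real^'n^'n \<Rightarrow> real^'n^'n" where
  "commutator X Y = X ** Y - Y ** X"

definition lie_ideal :: "(real^'n^'n) set \<Rightarrow> (real^'n^'n) set \<Rightarrow> bool" where
  "lie_ideal I L \<longleftrightarrow> subspace I \<and> I \<subseteq> L \<and> (\<forall>X\<in>L. \<forall>Y\<in>I. commutator X Y \<in> I)"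

definition derived_algebra :: "(real^'n^'n) set \<Rightarrow> (real^'n^'n) set" where
  "derived_algebra L = span {commutator X Y | X Y. X \<in> L \<and> Y \<in> L}"

definition lie_solvable :: "(real^'n^'n) set \<Rightarrow> bool" where
  "lie_solvable L \<longleftrightarrow> (\<exists>m. (derived_algebra ^^ m) L = {0})"

definition lie_semisimple :: "(real^'n^'n) set \<Rightarrow> bool" where
  "lie_semisimple L \<longleftrightarrow> (\<forall>I. lie_ideal I L \<and> lie_solvable I \<longrightarrow> I = {0})"

definition involutive_automorphism ::
  "(real^'n^'n) set \<Rightarrow> (real^'n^'n \<Rightarrow> real^'n^'n) \<Rightarrow> bool" where
  "involutive_automorphism L \<theta> \<longleftrightarrow>
     (\<forall>X\<in>L. \<theta> X \<in> L \<and> \<theta> (\<theta> X) = X) \<and>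
     (\<forall>X\<in>L. \<forall>Y\<in>L. \<theta> (X + Y) = \<theta> X + \<theta> Y) \<and>
     (\<forall>c::real. \<forall>X\<in>L. \<theta> (c *\<^sub>R X) = c *\<^sub>R \<theta> X) \<and>
     (\<forall>X\<in>L. \<forall>Y\<in>L. \<theta> (commutator X Y) = commutator (\<theta> X) (\<theta> Y))"

definition cartan_decomposition ::
  "(real^'n^'n) set \<Rightarrow> (real^'n^'n) set \<Rightarrow> (real^'n^'n) set \<Rightarrow> bool" where
  "cartan_decomposition L \<tt> \<pp> \<longleftrightarrow>
     (\<exists>\<theta>. involutive_automorphism L \<theta> \<and>
          \<tt> = {X \<in> L. \<theta> X = X} \<and> \<pp> = {X \<in> L. \<theta> X = - X})"

definition Ad :: "real^'n^'n \<Rightarrow> real^'n^'n \<Rightarrow> real^'n^'n" where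
  "Ad k v = k ** v ** matrix_inv k"

definition cartan_motion_group ::
  "(real^'n^'n) set \<Rightarrow> (real^'n^'n) set \<Rightarrow> ((real^'n^'n) \<times> (real^'n^'n)) monoid" where
  "cartan_motion_group K V =
     \<lparr>carrier = K \<times> V,
      mult = (\<lambda>(k1, v1) (k2, v2). (k1 ** k2, v1 + Ad k1 v2)),
      one = (mat 1, 0)\<rparr>"

definition Psi :: "real \<Rightarrow> (real^'n^'n) \<times> (real^'n^'n) \<Rightarrow> real^'n^'n" where
  "Psi lam = (\<lambda>(k, v). matrix_exp ((1 / lam) *\<^sub>R v) ** k)"

end

theory Submission
  imports Defs
begin

text \<open>
  Estimate (ii) is the second-order estimate for \<open>exp (s(A + B)) - exp (sA) exp (sB)\<close> at
  \<open>s = 1/\<lambda>\<close>, with \<open>A = v\<^sub>1\<close> and \<open>B = Ad k\<^sub>1 v\<^sub>2\<close>: right multiplication by the orthogonal matrix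
  \<open>k\<^sub>1 k\<^sub>2\<close> preserves the Frobenius norm, and \<open>k\<^sub>1 exp (s v\<^sub>2) = exp (s Ad k\<^sub>1 v\<^sub>2) k\<^sub>1\<close>.

  Identity (i) is a computation once inverses exist in the motion group, that is, once \<open>\<pp>\<close> is
  invariant under \<open>Ad k\<close> for every \<open>k \<in> K\<close>. As \<open>K\<close> may be disconnected, this does not follow from
  \<open>[\<tt>, \<pp>] \<subseteq> \<pp>\<close>. But \<open>Ad k\<close> preserves \<open>\<tt>\<close>, the Lie algebra of \<open>K\<close>, and \<open>\<pp>\<close> is the orthogonal
  complement of \<open>\<tt>\<close> for the Killing form, which is invariant under automorphisms and definite since
  the algebra is semisimple and consists of skew-symmetric matrices.
\<close>

section \<open>Frobenius geometry of matrices\<close>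

lemma norm_matrix_mult_le:
  fixes A :: "real^'k^'m" and B :: "real^'n^'k"
  shows "norm (A ** B) \<le> norm A * norm B"
proof -
  have row: "norm ((A ** B) $ i) \<le> norm (A $ i) * norm B" for i
  proof -
    have "(A ** B) $ i = (\<Sum>k\<in>UNIV. A $ i $ k *\<^sub>R B $ k)"
      by (simp add: vec_eq_iff matrix_matrix_mult_def)
    then have "norm ((A ** B) $ i) \<le> (\<Sum>k\<in>UNIV. \<bar>A $ i $ k\<bar> * \<bar>norm (B $ k)\<bar>)"
      using norm_sum[of "\<lambda>k. A $ i $ k *\<^sub>R B $ k" UNIV] by simp
    also have "\<dots> \<le> L2_set (\<lambda>k. A $ i $ k) UNIV * L2_set (\<lambda>k. norm (B $ k)) UNIV"
      by (rule L2_set_mult_ineq)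
    also have "\<dots> = norm (A $ i) * norm B"
      by (simp add: norm_vec_def L2_set_def)
    finally show ?thesis .
  qed
  have "norm (A ** B) = L2_set (\<lambda>i. norm ((A ** B) $ i)) UNIV"
    by (simp add: norm_vec_def)
  also have "\<dots> \<le> L2_set (\<lambda>i. norm (A $ i) * norm B) UNIV"
    by (rule L2_set_mono) (use row in auto)
  also have "\<dots> = norm A * norm B"
    by (simp add: norm_vec_def[of A] L2_set_left_distrib)
  finally show ?thesis .
qed

interpretation matrix_mult: bounded_bilinear
  "(**) :: real^'n^'n \<Rightarrow> real^'n^'n \<Rightarrow> real^'n^'n"
proof
  show "\<exists>K. \<forall>A B :: real^'n^'n. norm (A ** B) \<le> norm A * norm B * K"
    by (rule exI[of _ 1]) (simp add: norm_matrix_mult_le)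
qed (simp_all add: vec_eq_iff matrix_matrix_mult_def algebra_simps sum.distrib sum_distrib_left)

lemma bounded_linear_transpose: "bounded_linear (transpose :: real^'n^'n \<Rightarrow> real^'n^'n)"
  unfolding linear_conv_bounded_linear[symmetric]
  by (simp add: linear_iff transpose_def vec_eq_iff)

lemma inner_transpose_transpose:
  fixes A B :: "real^'n^'n"
  shows "transpose A \<bullet> transpose B = A \<bullet> B"
  by (simp add: inner_vec_def transpose_def) (rule sum.swap)

lemma inner_matrix_mult_left:
  fixes A B C :: "real^'n^'n"
  shows "(A ** B) \<bullet> C = B \<bullet> (transpose A ** C)"
proof -
  have "(A ** B) \<bullet> C = (\<Sum>i\<in>UNIV. \<Sum>j\<in>UNIV. \<Sum>k\<in>UNIV. A $ i $ k * B $ k $ j * C $ i $ j)"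
    by (simp add: inner_vec_def matrix_matrix_mult_def sum_distrib_right)
  also have "\<dots> = (\<Sum>i\<in>UNIV. \<Sum>k\<in>UNIV. \<Sum>j\<in>UNIV. A $ i $ k * B $ k $ j * C $ i $ j)"
    by (intro sum.cong refl sum.swap)
  also have "\<dots> = (\<Sum>k\<in>UNIV. \<Sum>i\<in>UNIV. \<Sum>j\<in>UNIV. A $ i $ k * B $ k $ j * C $ i $ j)"
    by (rule sum.swap)
  also have "\<dots> = (\<Sum>k\<in>UNIV. \<Sum>j\<in>UNIV. \<Sum>i\<in>UNIV. A $ i $ k * B $ k $ j * C $ i $ j)"
    by (intro sum.cong refl sum.swap)
  also have "\<dots> = B \<bullet> (transpose A ** C)"
    by (simp add: inner_vec_def matrix_matrix_mult_def transpose_def sum_distrib_left mult_ac)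
  finally show ?thesis .
qed

lemma inner_matrix_mult_right:
  fixes A B C :: "real^'n^'n"
  shows "(A ** B) \<bullet> C = A \<bullet> (C ** transpose B)"
proof -
  have "(A ** B) \<bullet> C = (transpose B ** transpose A) \<bullet> transpose C"
    by (simp add: inner_transpose_transpose flip: matrix_transpose_mul)
  also have "\<dots> = transpose A \<bullet> transpose (C ** transpose B)"
    by (simp add: inner_matrix_mult_left matrix_transpose_mul)
  finally show ?thesis
    by (simp add: inner_transpose_transpose)
qed

lemma norm_orthogonal_matrix_mult:
  fixes Q A :: "real^'n^'n"
  assumes "orthogonal_matrix Q"
  shows "norm (Q ** A) = norm A" "norm (A ** Q) = norm A"
  using assms
  by (simp_all add: norm_eq_sqrt_inner inner_matrix_mult_left[of Q] inner_matrix_mult_right[of A Q]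
      orthogonal_matrix_def matrix_mul_assoc)
     (simp add: orthogonal_matrix_def flip: matrix_mul_assoc)

lemma matrix_inv_unique_right:
  fixes A B :: "real^'n^'n"
  assumes "A ** B = mat 1"
  shows "matrix_inv A = B"
proof -
  have "B ** A = mat 1"
    using assms by (simp add: matrix_left_right_inverse)
  then have "A ** matrix_inv A = mat 1"
    unfolding matrix_inv_def using assms by (metis (mono_tags, lifting) someI_ex)
  then show ?thesis
    using \<open>B ** A = mat 1\<close> by (metis matrix_mul_assoc matrix_mul_lid matrix_mul_rid)
qed

lemma matrix_inv_orthogonal:
  fixes Q :: "real^'n^'n"
  assumes "orthogonal_matrix Q"
  shows "matrix_inv Q = transpose Q"
  using assms by (simp add: matrix_inv_unique_right orthogonal_matrix_def)

section \<open>The matrix exponential\<close>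

abbreviation mpow :: "real^'n^'n \<Rightarrow> nat \<Rightarrow> real^'n^'n" where
  "mpow X k \<equiv> ((**) X ^^ k) (mat 1)"

lemma mpow_commute: "mpow X k ** X = X ** mpow X k"
  by (induction k) (simp_all add: matrix_mul_assoc flip: matrix_mul_assoc)

lemma mpow_add: "mpow X i ** mpow X j = mpow X (i + j)"
  by (induction i) (simp_all flip: matrix_mul_assoc)

lemma mpow_scaleR: "mpow (s *\<^sub>R X) k = s ^ k *\<^sub>R mpow X k"
  by (induction k) (simp_all add: matrix_mult.scaleR_left matrix_mult.scaleR_right)

lemma transpose_mpow: "transpose (mpow X k) = mpow (transpose X) k"
  by (induction k) (simp_all add: matrix_transpose_mul mpow_commute)

lemma mpow_conj:
  fixes P Q X :: "real^'n^'n"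
  assumes "P ** Q = mat 1" "Q ** P = mat 1"
  shows "mpow (P ** X ** Q) k = P ** mpow X k ** Q"
proof (induction k)
  case (Suc k)
  have "mpow (P ** X ** Q) (Suc k) = P ** X ** (Q ** P) ** mpow X k ** Q"
    by (simp add: Suc.IH matrix_mul_assoc)
  then show ?case
    using assms by (simp add: matrix_mul_assoc)
qed (use assms in simp)

lemma norm_mpow_le:
  fixes X :: "real^'n^'n"
  shows "norm (mpow X k) \<le> norm (mat 1 :: real^'n^'n) * norm X ^ k"
proof (induction k)
  case (Suc k)
  have "norm (mpow X (Suc k)) \<le> norm X * norm (mpow X k)"
    by (simp add: norm_matrix_mult_le)
  also have "\<dots> \<le> norm X * (norm (mat 1 :: real^'n^'n) * norm X ^ k)"
    by (rule mult_left_mono[OF Suc.IH]) simp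
  finally show ?case by (simp add: mult_ac)
qed simp

lemma norm_exp_term_le:
  fixes X :: "real^'n^'n"
  shows "norm ((1 / fact k) *\<^sub>R mpow X k) \<le> norm (mat 1 :: real^'n^'n) * (inverse (fact k) * norm X ^ k)"
  using norm_mpow_le[of k X] by (simp add: field_simps)

lemma summable_norm_matrix_exp:
  fixes X :: "real^'n^'n"
  shows "summable (\<lambda>k. norm ((1 / fact k) *\<^sub>R mpow X k))"
  by (rule summable_comparison_test'[OF summable_mult[OF summable_exp[of "norm X"],
          of "norm (mat 1 :: real^'n^'n)"]])
     (simp only: real_norm_def abs_norm_cancel norm_exp_term_le)

lemma matrix_exp_sums:
  fixes X :: "real^'n^'n"
  shows "(\<lambda>k. (1 / fact k) *\<^sub>R mpow X k) sums matrix_exp X"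
  unfolding matrix_exp_def
  by (rule summable_sums[OF summable_norm_cancel[OF summable_norm_matrix_exp]])

lemma matrix_exp_zero [simp]: "matrix_exp 0 = (mat 1 :: real^'n^'n)"
proof -
  have "(1 / fact k) *\<^sub>R mpow (0::real^'n^'n) k = 0" if "k \<notin> {0}" for k
    using that by (cases k) (simp_all add: matrix_mult.zero_left)
  then have "(\<lambda>k. (1 / fact k) *\<^sub>R mpow (0::real^'n^'n) k) sums mat 1"
    using sums_finite[of "{0}" "\<lambda>k. (1 / fact k) *\<^sub>R mpow (0::real^'n^'n) k"] by simp
  then show ?thesis
    using matrix_exp_sums sums_unique2 by fastforce
qed

lemma transpose_matrix_exp: "transpose (matrix_exp X) = matrix_exp (transpose X)"
proof -
  have "(\<lambda>k. transpose ((1 / fact k) *\<^sub>R mpow X k)) sums transpose (matrix_exp X)"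
    by (rule bounded_linear.sums[OF bounded_linear_transpose matrix_exp_sums])
  then have "(\<lambda>k. (1 / fact k) *\<^sub>R mpow (transpose X) k) sums transpose (matrix_exp X)"
    by (simp add: transpose_scalar transpose_mpow)
  then show ?thesis
    using matrix_exp_sums sums_unique2 by blast
qed

lemma matrix_exp_conj:
  fixes P Q X :: "real^'n^'n"
  assumes "P ** Q = mat 1" "Q ** P = mat 1"
  shows "matrix_exp (P ** X ** Q) = P ** matrix_exp X ** Q"
proof -
  have "bounded_linear (\<lambda>A. P ** A ** Q)"
    by (intro bounded_linear_compose[OF matrix_mult.bounded_linear_left
          matrix_mult.bounded_linear_right])
  from bounded_linear.sums[OF this matrix_exp_sums[of X]]
  have "(\<lambda>k. (1 / fact k) *\<^sub>R mpow (P ** X ** Q) k) sums (P ** matrix_exp X ** Q)"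
    by (simp add: mpow_conj[OF assms] matrix_mult.scaleR_left matrix_mult.scaleR_right)
  then show ?thesis
    using matrix_exp_sums sums_unique2 by blast
qed

lemma matrix_Cauchy_product_sums:
  fixes a b :: "nat \<Rightarrow> real^'n^'n"
  assumes "summable (\<lambda>k. norm (a k))" "summable (\<lambda>k. norm (b k))"
  shows "(\<lambda>k. \<Sum>i\<le>k. a i ** b (k - i)) sums ((\<Sum>k. a k) ** (\<Sum>k. b k))"
proof -
  have entry: "summable (\<lambda>k. norm (c k $ i $ j))" "(\<Sum>k. c k) $ i $ j = (\<Sum>k. c k $ i $ j)"
    if c: "summable (\<lambda>k. norm (c k))" for c :: "nat \<Rightarrow> real^'n^'n" and i j
  proof -
    have "norm (norm (c k $ i $ j)) \<le> norm (c k)" for k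
      using order_trans[OF Finite_Cartesian_Product.norm_nth_le[of "c k $ i" j] Finite_Cartesian_Product.norm_nth_le[of "c k" i]] by simp
    then show "summable (\<lambda>k. norm (c k $ i $ j))"
      by (rule summable_comparison_test'[OF c])
    have "bounded_linear (\<lambda>A::real^'n^'n. A $ i $ j)"
      by (intro bounded_linear_compose[OF bounded_linear_vec_nth bounded_linear_vec_nth])
    from bounded_linear.suminf[OF this summable_norm_cancel[OF c]]
    show "(\<Sum>k. c k) $ i $ j = (\<Sum>k. c k $ i $ j)" .
  qed
  have sums_iff: "f sums F" if "\<And>i j. (\<lambda>k. f k $ i $ j) sums (F $ i $ j)"
    for f :: "nat \<Rightarrow> real^'n^'n" and F
    using that unfolding sums_def by (simp add: vec_tendstoI)
  show ?thesis
  proof (rule sums_iff)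
    fix i j
    have "(\<lambda>k. \<Sum>l\<in>UNIV. \<Sum>m\<le>k. a m $ i $ l * b (k - m) $ l $ j)
            sums (\<Sum>l\<in>UNIV. (\<Sum>k. a k $ i $ l) * (\<Sum>k. b k $ l $ j))"
      by (intro sums_sum Cauchy_product_sums entry assms)
    then show "(\<lambda>k. (\<Sum>m\<le>k. a m ** b (k - m)) $ i $ j)
            sums (((\<Sum>k. a k) ** (\<Sum>k. b k)) $ i $ j)"
      by (simp add: matrix_matrix_mult_def entry assms sum.swap[of _ _ UNIV])
  qed
qed

lemma matrix_exp_add: "matrix_exp (s *\<^sub>R X) ** matrix_exp (t *\<^sub>R X) = matrix_exp ((s + t) *\<^sub>R X)"
proof -
  have "(\<Sum>i\<le>k. ((1 / fact i) *\<^sub>R mpow (s *\<^sub>R X) i) ** ((1 / fact (k - i)) *\<^sub>R mpow (t *\<^sub>R X) (k - i)))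
      = (1 / fact k) *\<^sub>R mpow ((s + t) *\<^sub>R X) k" for k
  proof -
    have "(\<Sum>i\<le>k. ((1 / fact i) *\<^sub>R mpow (s *\<^sub>R X) i) ** ((1 / fact (k - i)) *\<^sub>R mpow (t *\<^sub>R X) (k - i)))
        = (\<Sum>i\<le>k. (1 / fact k * (of_nat (k choose i) * s ^ i * t ^ (k - i))) *\<^sub>R mpow X k)"
      by (intro sum.cong refl)
         (simp add: mpow_scaleR matrix_mult.scaleR_left matrix_mult.scaleR_right mpow_add
            binomial_fact field_simps)
    also have "\<dots> = (1 / fact k * (s + t) ^ k) *\<^sub>R mpow X k"
      by (simp only: binomial_ring sum_distrib_left flip: scaleR_sum_left)
    finally show ?thesis
      by (simp add: mpow_scaleR)
  qed
  then show ?thesis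
    using matrix_Cauchy_product_sums[OF summable_norm_matrix_exp[of "s *\<^sub>R X"]
        summable_norm_matrix_exp[of "t *\<^sub>R X"]]
    unfolding matrix_exp_def by (simp add: sums_iff)
qed

lemma matrix_exp_minus: "matrix_exp X ** matrix_exp (- X) = mat 1"
  using matrix_exp_add[of 1 X "-1"] by simp

lemma mpow_matrix_exp: "mpow (matrix_exp X) n = matrix_exp (real n *\<^sub>R X)"
  by (induction n) (use matrix_exp_add[of 1 X] in \<open>simp_all add: add.commute\<close>)

lemma orthogonal_matrix_exp_skew:
  assumes "transpose X = - X"
  shows "orthogonal_matrix (matrix_exp X)"
  using matrix_exp_minus[of "-X"] by (simp add: orthogonal_matrix transpose_matrix_exp assms)

lemma norm_matrix_exp_remainder:
  fixes X :: "real^'n^'n"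
  shows "norm (matrix_exp X - mat 1 - X) \<le> norm (mat 1 :: real^'n^'n) * (norm X)\<^sup>2 * exp (norm X)"
proof -
  let ?a = "\<lambda>k. (1 / fact k) *\<^sub>R mpow X k"
  have "(\<lambda>k. ?a (k + 2)) sums (matrix_exp X - (\<Sum>k<2. ?a k))"
    by (rule sums_split_initial_segment[OF matrix_exp_sums])
  then have sums: "(\<lambda>k. ?a (k + 2)) sums (matrix_exp X - mat 1 - X)"
    by (simp add: numeral_2_eq_2 algebra_simps)
  let ?g = "\<lambda>k. norm (mat 1 :: real^'n^'n) * (norm X)\<^sup>2 * (norm X ^ k /\<^sub>R fact k)"
  have g: "?g sums (norm (mat 1 :: real^'n^'n) * (norm X)\<^sup>2 * exp (norm X))"
    by (intro sums_mult exp_converges)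
  have "norm (?a (k + 2)) \<le> ?g k" for k
  proof -
    have "inverse (fact (k + 2)) \<le> (inverse (fact k) :: real)"
      by (intro le_imp_inverse_le fact_mono) auto
    then have "norm (mat 1 :: real^'n^'n) * (inverse (fact (k + 2)) * norm X ^ (k + 2))
        \<le> norm (mat 1 :: real^'n^'n) * (inverse (fact k) * norm X ^ (k + 2))"
      by (intro mult_left_mono mult_right_mono) auto
    with norm_exp_term_le[of "k + 2" X]
    have "norm (?a (k + 2)) \<le> norm (mat 1 :: real^'n^'n) * (inverse (fact k) * norm X ^ (k + 2))"
      by (rule order_trans)
    then show ?thesis
      by (simp only: power_add mult_ac real_scaleR_def)
  qed
  then show ?thesis
    using norm_suminf_le[of "\<lambda>k. ?a (k + 2)" ?g] sums g by (simp add: sums_iff)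
qed

lemma matrix_exp_first_order:
  fixes X :: "real^'n^'n"
  shows "\<exists>C\<ge>0. \<forall>s. \<bar>s\<bar> \<le> 1 \<longrightarrow> norm (matrix_exp (s *\<^sub>R X) - mat 1 - s *\<^sub>R X) \<le> C * s\<^sup>2"
proof (intro exI conjI allI impI)
  let ?C = "norm (mat 1 :: real^'n^'n) * (norm X)\<^sup>2 * exp (norm X)"
  show "0 \<le> ?C" by simp
  fix s :: real assume "\<bar>s\<bar> \<le> 1"
  then have "exp (norm (s *\<^sub>R X)) \<le> exp (norm X)"
    using mult_right_mono[of "\<bar>s\<bar>" 1 "norm X"] by simp
  then have "norm (mat 1 :: real^'n^'n) * (norm (s *\<^sub>R X))\<^sup>2 * exp (norm (s *\<^sub>R X))
      \<le> norm (mat 1 :: real^'n^'n) * (norm (s *\<^sub>R X))\<^sup>2 * exp (norm X)"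
    by (intro mult_left_mono) auto
  also have "\<dots> = ?C * s\<^sup>2"
    by (simp add: power_mult_distrib)
  finally show "norm (matrix_exp (s *\<^sub>R X) - mat 1 - s *\<^sub>R X) \<le> ?C * s\<^sup>2"
    using norm_matrix_exp_remainder[of "s *\<^sub>R X"] by linarith
qed

lemma matrix_exp_add_approx:
  fixes A B :: "real^'n^'n"
  shows "\<exists>C\<ge>0. \<forall>s. \<bar>s\<bar> \<le> 1 \<longrightarrow>
    norm (matrix_exp (s *\<^sub>R (A + B)) - matrix_exp (s *\<^sub>R A) ** matrix_exp (s *\<^sub>R B)) \<le> C * s\<^sup>2"
proof -
  let ?R = "\<lambda>X s. matrix_exp (s *\<^sub>R X) - mat 1 - s *\<^sub>R X"
  obtain a b c where "a \<ge> 0" and a: "\<And>s. \<bar>s\<bar> \<le> 1 \<Longrightarrow> norm (?R A s) \<le> a * s\<^sup>2"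
    and "b \<ge> 0" and b: "\<And>s. \<bar>s\<bar> \<le> 1 \<Longrightarrow> norm (?R B s) \<le> b * s\<^sup>2"
    and "c \<ge> 0" and c: "\<And>s. \<bar>s\<bar> \<le> 1 \<Longrightarrow> norm (?R (A + B) s) \<le> c * s\<^sup>2"
    using matrix_exp_first_order by metis
  define N where "N = norm (mat 1 :: real^'n^'n) + norm B + b"
  let ?C = "c + a * N + b + norm A * b + norm A * norm B"
  have "N \<ge> 0"
    using \<open>b \<ge> 0\<close> by (simp add: N_def)
  have "norm (matrix_exp (s *\<^sub>R (A + B)) - matrix_exp (s *\<^sub>R A) ** matrix_exp (s *\<^sub>R B)) \<le> ?C * s\<^sup>2"
    if s: "\<bar>s\<bar> \<le> 1" for s
  proof -
    have "s\<^sup>2 \<le> 1"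
      using s by (simp add: abs_square_le_1)
    have sX: "norm (s *\<^sub>R X) \<le> norm X" for X :: "real^'n^'n"
      using s mult_right_mono[of "\<bar>s\<bar>" 1 "norm X"] by simp
    have "norm (matrix_exp (s *\<^sub>R B)) \<le> norm (mat 1 :: real^'n^'n) + norm (s *\<^sub>R B) + norm (?R B s)"
      using norm_triangle_ineq[of "mat 1 + s *\<^sub>R B" "?R B s"]
        norm_triangle_ineq[of "mat 1" "s *\<^sub>R B"] by simp
    moreover have "b * s\<^sup>2 \<le> b"
      using mult_left_mono[OF \<open>s\<^sup>2 \<le> 1\<close> \<open>b \<ge> 0\<close>] by simp
    ultimately have N: "norm (matrix_exp (s *\<^sub>R B)) \<le> N"
      using b[OF s] sX[of B] unfolding N_def by linarith
    have "matrix_exp (s *\<^sub>R (A + B)) - matrix_exp (s *\<^sub>R A) ** matrix_exp (s *\<^sub>R B)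
        = ?R (A + B) s - ?R A s ** matrix_exp (s *\<^sub>R B) - ?R B s - s *\<^sub>R A ** ?R B s - s\<^sup>2 *\<^sub>R (A ** B)"
      by (simp add: matrix_mult.diff_left matrix_mult.diff_right matrix_mult.add_left
          matrix_mult.add_right matrix_mult.scaleR_left matrix_mult.scaleR_right power2_eq_square algebra_simps)
    then have "norm (matrix_exp (s *\<^sub>R (A + B)) - matrix_exp (s *\<^sub>R A) ** matrix_exp (s *\<^sub>R B))
        = norm (?R (A + B) s - ?R A s ** matrix_exp (s *\<^sub>R B) - ?R B s - s *\<^sub>R A ** ?R B s - s\<^sup>2 *\<^sub>R (A ** B))"
      by (rule arg_cong)
    also have "\<dots> \<le> norm (?R (A + B) s) + norm (?R A s ** matrix_exp (s *\<^sub>R B)) + norm (?R B s)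
        + norm (s *\<^sub>R A ** ?R B s) + norm (s\<^sup>2 *\<^sub>R (A ** B))"
    proof -
      have "norm (u - v - w - x - y) \<le> norm u + norm v + norm w + norm x + norm y"
        for u v w x y :: "real^'n^'n"
        using norm_triangle_ineq4[of "u - v - w - x" y] norm_triangle_ineq4[of "u - v - w" x]
          norm_triangle_ineq4[of "u - v" w] norm_triangle_ineq4[of u v] by linarith
      then show ?thesis .
    qed
    also have "\<dots> \<le> c * s\<^sup>2 + a * s\<^sup>2 * N + b * s\<^sup>2 + norm A * (b * s\<^sup>2) + s\<^sup>2 * (norm A * norm B)"
    proof (intro add_mono)
      show "norm (?R A s ** matrix_exp (s *\<^sub>R B)) \<le> a * s\<^sup>2 * N"
        using \<open>a \<ge> 0\<close> by (intro order_trans[OF norm_matrix_mult_le] mult_mono a s N) auto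
      show "norm (s *\<^sub>R A ** ?R B s) \<le> norm A * (b * s\<^sup>2)"
        by (rule order_trans[OF norm_matrix_mult_le mult_mono[OF sX b[OF s]]]) auto
      show "norm (s\<^sup>2 *\<^sub>R (A ** B)) \<le> s\<^sup>2 * (norm A * norm B)"
        by (simp add: norm_matrix_mult_le mult_left_mono)
    qed (use b c s in auto)
    finally show ?thesis
      by (simp add: algebra_simps)
  qed
  moreover have "?C \<ge> 0"
    using \<open>a \<ge> 0\<close> \<open>b \<ge> 0\<close> \<open>c \<ge> 0\<close> \<open>N \<ge> 0\<close> by simp
  ultimately show ?thesis
    by blast
qed

lemma matrix_exp_conj_approx:
  fixes X Y :: "real^'n^'n"
  assumes "\<And>s. orthogonal_matrix (matrix_exp (s *\<^sub>R X))"
  shows "\<exists>C\<ge>0. \<forall>s. \<bar>s\<bar> \<le> 1 \<longrightarrow>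
    norm (matrix_exp (s *\<^sub>R X) ** Y ** matrix_exp (- (s *\<^sub>R X)) - Y - s *\<^sub>R commutator X Y) \<le> C * s\<^sup>2"
proof -
  let ?R = "\<lambda>s. matrix_exp (s *\<^sub>R X) - mat 1 - s *\<^sub>R X"
  obtain a where "a \<ge> 0" and a: "\<And>s. \<bar>s\<bar> \<le> 1 \<Longrightarrow> norm (?R s) \<le> a * s\<^sup>2"
    using matrix_exp_first_order by metis
  let ?C = "a * norm Y + norm Y * a + norm X * norm Y * a + norm (X ** Y ** X)"
  have "norm (matrix_exp (s *\<^sub>R X) ** Y ** matrix_exp (- (s *\<^sub>R X)) - Y - s *\<^sub>R commutator X Y) \<le> ?C * s\<^sup>2"
    if s: "\<bar>s\<bar> \<le> 1" for s
  proof -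
    have sX: "norm (s *\<^sub>R X) \<le> norm X"
      using s mult_right_mono[of "\<bar>s\<bar>" 1 "norm X"] by simp
    have a': "norm (?R (- s)) \<le> a * s\<^sup>2"
      using a[of "- s"] s by simp
    have "matrix_exp (s *\<^sub>R X) ** Y ** matrix_exp (- (s *\<^sub>R X)) - Y - s *\<^sub>R commutator X Y
        = ?R s ** Y ** matrix_exp ((- s) *\<^sub>R X) + Y ** ?R (- s) + s *\<^sub>R X ** Y ** ?R (- s)
          - s\<^sup>2 *\<^sub>R (X ** Y ** X)"
      by (simp add: commutator_def matrix_mult.diff_left matrix_mult.diff_right
          matrix_mult.add_left matrix_mult.add_right matrix_mult.minus_right
          matrix_mult.scaleR_left matrix_mult.scaleR_right power2_eq_square algebra_simps)
    then have "norm (matrix_exp (s *\<^sub>R X) ** Y ** matrix_exp (- (s *\<^sub>R X)) - Y - s *\<^sub>R commutator X Y)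
        = norm (?R s ** Y ** matrix_exp ((- s) *\<^sub>R X) + Y ** ?R (- s) + s *\<^sub>R X ** Y ** ?R (- s)
          - s\<^sup>2 *\<^sub>R (X ** Y ** X))"
      by (rule arg_cong)
    also have "\<dots> \<le> norm (?R s ** Y ** matrix_exp ((- s) *\<^sub>R X)) + norm (Y ** ?R (- s))
        + norm (s *\<^sub>R X ** Y ** ?R (- s)) + norm (s\<^sup>2 *\<^sub>R (X ** Y ** X))"
    proof -
      have "norm (u + v + w - x) \<le> norm u + norm v + norm w + norm x" for u v w x :: "real^'n^'n"
        using norm_triangle_ineq4[of "u + v + w" x] norm_triangle_ineq[of "u + v" w]
          norm_triangle_ineq[of u v] by linarith
      then show ?thesis .
    qed
    also have "\<dots> \<le> a * s\<^sup>2 * norm Y + norm Y * (a * s\<^sup>2) + norm X * norm Y * (a * s\<^sup>2)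
        + s\<^sup>2 * norm (X ** Y ** X)"
    proof (intro add_mono)
      have "norm (?R s ** Y ** matrix_exp ((- s) *\<^sub>R X)) = norm (?R s ** Y)"
        by (rule norm_orthogonal_matrix_mult(2)[OF assms])
      also have "\<dots> \<le> a * s\<^sup>2 * norm Y"
        by (intro order_trans[OF norm_matrix_mult_le] mult_right_mono a s) auto
      finally show "norm (?R s ** Y ** matrix_exp ((- s) *\<^sub>R X)) \<le> a * s\<^sup>2 * norm Y" .
      show "norm (Y ** ?R (- s)) \<le> norm Y * (a * s\<^sup>2)"
        by (intro order_trans[OF norm_matrix_mult_le] mult_left_mono a') auto
      have "norm (s *\<^sub>R X ** Y) \<le> norm X * norm Y"
        by (intro order_trans[OF norm_matrix_mult_le] mult_right_mono sX) auto
      then show "norm (s *\<^sub>R X ** Y ** ?R (- s)) \<le> norm X * norm Y * (a * s\<^sup>2)"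
        by (rule order_trans[OF norm_matrix_mult_le mult_mono[OF _ a']]) auto
    qed auto
    finally show ?thesis
      by (simp add: algebra_simps)
  qed
  moreover have "?C \<ge> 0"
    using \<open>a \<ge> 0\<close> by simp
  ultimately show ?thesis
    by blast
qed

lemma nonpos_if_linear_le_quadratic:
  fixes a C :: real
  assumes "\<And>s. 0 < s \<Longrightarrow> s \<le> 1 \<Longrightarrow> s * a \<le> C * s\<^sup>2"
  shows "a \<le> 0"
proof (rule LIMSEQ_le_const)
  show "(\<lambda>n. C * inverse (real (Suc n))) \<longlonglongrightarrow> 0"
    using tendsto_mult_right_zero[OF LIMSEQ_inverse_real_of_nat] by blast
  have "a \<le> C * s" if "0 < s" "s \<le> 1" for s
    using assms[OF that] that by (simp add: power2_eq_square)
  then show "\<exists>N. \<forall>n\<ge>N. a \<le> C * inverse (real (Suc n))"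
    by (simp add: inverse_le_1_iff)
qed

lemma skew_if_matrix_exp_orthogonal:
  fixes X :: "real^'n^'n"
  assumes "\<And>s. orthogonal_matrix (matrix_exp (s *\<^sub>R X))"
  shows "transpose X = - X"
proof -
  let ?Z = "transpose X + X"
  obtain a where a: "\<And>s. \<bar>s\<bar> \<le> 1 \<Longrightarrow> norm (matrix_exp (s *\<^sub>R ?Z)
      - matrix_exp (s *\<^sub>R transpose X) ** matrix_exp (s *\<^sub>R X)) \<le> a * s\<^sup>2"
    using matrix_exp_add_approx by metis
  obtain b where b: "\<And>s. \<bar>s\<bar> \<le> 1 \<Longrightarrow> norm (matrix_exp (s *\<^sub>R ?Z) - mat 1 - s *\<^sub>R ?Z) \<le> b * s\<^sup>2"
    using matrix_exp_first_order by metis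
  have "s * norm ?Z \<le> (a + b) * s\<^sup>2" if "0 < s" "s \<le> 1" for s
  proof -
    have "matrix_exp (s *\<^sub>R transpose X) ** matrix_exp (s *\<^sub>R X) = mat 1"
      using assms[of s] by (simp add: orthogonal_matrix transpose_matrix_exp transpose_scalar)
    then have "norm (matrix_exp (s *\<^sub>R ?Z) - mat 1) \<le> a * s\<^sup>2"
      using a[of s] that by simp
    moreover have "norm (s *\<^sub>R ?Z) \<le> norm (matrix_exp (s *\<^sub>R ?Z) - mat 1)
        + norm (matrix_exp (s *\<^sub>R ?Z) - mat 1 - s *\<^sub>R ?Z)"
      using norm_triangle_ineq4[of "matrix_exp (s *\<^sub>R ?Z) - mat 1"
          "matrix_exp (s *\<^sub>R ?Z) - mat 1 - s *\<^sub>R ?Z"] by simp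
    ultimately show ?thesis
      using b[of s] that unfolding distrib_right by simp
  qed
  then have "?Z = 0"
    using nonpos_if_linear_le_quadratic[of "norm ?Z" "a + b"] by simp
  then show ?thesis
    by (simp add: eq_neg_iff_add_eq_0)
qed

section \<open>The Lie algebra of a closed group of orthogonal matrices\<close>

lemma group_orthogonal_group: "group (orthogonal_group :: (real^'n^'n) monoid)"
proof (rule groupI)
  fix Q :: "real^'n^'n"
  assume "Q \<in> carrier orthogonal_group"
  then show "\<exists>P\<in>carrier orthogonal_group. P \<otimes>\<^bsub>orthogonal_group\<^esub> Q = \<one>\<^bsub>orthogonal_group\<^esub>"
    by (intro bexI[of _ "transpose Q"]) (auto simp: orthogonal_group_def orthogonal_matrix_def)
qed (auto simp: orthogonal_group_def orthogonal_matrix_mul orthogonal_matrix_id matrix_mul_assoc)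

lemma subgroup_orthogonalD:
  fixes G :: "(real^'n^'n) set"
  assumes "subgroup G orthogonal_group"
  shows "\<And>g. g \<in> G \<Longrightarrow> orthogonal_matrix g" "mat 1 \<in> G"
    "\<And>g h. g \<in> G \<Longrightarrow> h \<in> G \<Longrightarrow> g ** h \<in> G" "\<And>g. g \<in> G \<Longrightarrow> transpose g \<in> G"
proof -
  interpret group "orthogonal_group :: (real^'n^'n) monoid"
    by (rule group_orthogonal_group)
  show orth: "orthogonal_matrix g" if "g \<in> G" for g
    using subgroup.subset[OF assms] that by (auto simp: orthogonal_group_def)
  show "mat 1 \<in> G"
    using subgroup.one_closed[OF assms] by (simp add: orthogonal_group_def)
  show "g ** h \<in> G" if "g \<in> G" "h \<in> G" for g h
    using subgroup.m_closed[OF assms that] by (simp add: orthogonal_group_def)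
  show "transpose g \<in> G" if "g \<in> G" for g
  proof -
    have "inv\<^bsub>orthogonal_group\<^esub> g = transpose g"
      using orth[OF that] by (intro inv_equality) (auto simp: orthogonal_group_def orthogonal_matrix_def)
    then show ?thesis
      using subgroup.m_inv_closed[OF assms that] by simp
  qed
qed

lemma norm_mpow_diff_le:
  fixes P Q :: "real^'n^'n"
  assumes "orthogonal_matrix P" "orthogonal_matrix Q"
  shows "norm (mpow P n - mpow Q n) \<le> real n * norm (P - Q)"
proof (induction n)
  case (Suc n)
  have orth: "orthogonal_matrix (mpow Q n)"
    by (induction n) (simp_all add: assms orthogonal_matrix_mul orthogonal_matrix_id)
  have "mpow P (Suc n) - mpow Q (Suc n) = P ** (mpow P n - mpow Q n) + (P - Q) ** mpow Q n"
    by (simp add: matrix_mult.diff_left matrix_mult.diff_right)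
  then have "norm (mpow P (Suc n) - mpow Q (Suc n)) \<le> norm (mpow P n - mpow Q n) + norm (P - Q)"
    using norm_triangle_ineq[of "P ** (mpow P n - mpow Q n)" "(P - Q) ** mpow Q n"]
    by (simp only: norm_orthogonal_matrix_mult[OF assms(1)] norm_orthogonal_matrix_mult[OF orth])
  with Suc.IH show ?case
    by (simp add: distrib_right)
qed simp

locale closed_orthogonal_subgroup =
  fixes G :: "(real^'n^'n) set"
  assumes subgroup: "subgroup G orthogonal_group" and closed: "closed G"
begin

lemmas subgroupD = subgroup_orthogonalD[OF subgroup]

lemma lie_algebraD: "X \<in> lie_algebra G \<Longrightarrow> matrix_exp (s *\<^sub>R X) \<in> G"
  by (simp add: lie_algebra_def)

lemma lie_algebra_skew: "X \<in> lie_algebra G \<Longrightarrow> transpose X = - X"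
  by (rule skew_if_matrix_exp_orthogonal) (rule subgroupD(1)[OF lie_algebraD])

lemma mpow_closed: "g \<in> G \<Longrightarrow> mpow g n \<in> G"
  by (induction n) (simp_all add: subgroupD)

text \<open>The Lie product formula: \<open>exp (A + B)\<close> is the limit of \<open>(exp (A/n) exp (B/n)) ^ n\<close>.\<close>

lemma lie_algebra_add:
  assumes X: "X \<in> lie_algebra G" and Y: "Y \<in> lie_algebra G"
  shows "X + Y \<in> lie_algebra G"
  unfolding lie_algebra_def
proof (intro CollectI allI)
  fix t :: real
  define A B where "A = t *\<^sub>R X" and "B = t *\<^sub>R Y"
  obtain C where "C \<ge> 0" and C: "\<And>s. \<bar>s\<bar> \<le> 1 \<Longrightarrow> norm (matrix_exp (s *\<^sub>R (A + B))
      - matrix_exp (s *\<^sub>R A) ** matrix_exp (s *\<^sub>R B)) \<le> C * s\<^sup>2"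
    using matrix_exp_add_approx by metis
  define r where "r n = inverse (real (Suc n))" for n
  define P where "P n = matrix_exp (r n *\<^sub>R A) ** matrix_exp (r n *\<^sub>R B)" for n
  define Q where "Q n = matrix_exp (r n *\<^sub>R (A + B))" for n
  have P: "P n \<in> G" for n
    using lie_algebraD[OF X, of "r n * t"] lie_algebraD[OF Y, of "r n * t"]
    by (simp add: P_def A_def B_def subgroupD)
  have Q: "orthogonal_matrix (Q n)" for n
    unfolding Q_def A_def B_def
    by (rule orthogonal_matrix_exp_skew)
       (simp add: transpose_scalar linear_add[OF bounded_linear.linear[OF bounded_linear_transpose]]
         lie_algebra_skew X Y algebra_simps)
  have Q_pow: "mpow (Q n) (Suc n) = matrix_exp (A + B)" for n
    unfolding Q_def mpow_matrix_exp by (simp add: r_def del: of_nat_Suc)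
  have "norm (mpow (P n) (Suc n) - matrix_exp (A + B)) \<le> C * r n" for n
  proof -
    have "norm (mpow (P n) (Suc n) - matrix_exp (A + B)) \<le> real (Suc n) * norm (P n - Q n)"
      using norm_mpow_diff_le[OF subgroupD(1)[OF P[of n]] Q[of n], of "Suc n"] by (simp only: Q_pow)
    also have "\<dots> \<le> real (Suc n) * (C * (r n)\<^sup>2)"
      using C[of "r n"] by (intro mult_left_mono)
        (auto simp: P_def Q_def r_def norm_minus_commute inverse_le_1_iff)
    also have "\<dots> = C * r n"
      by (simp add: r_def power2_eq_square del: of_nat_Suc)
    finally show ?thesis .
  qed
  moreover have "(\<lambda>n. C * r n) \<longlonglongrightarrow> 0"
    unfolding r_def using tendsto_mult_right_zero[OF LIMSEQ_inverse_real_of_nat] by blast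
  ultimately have "(\<lambda>n. mpow (P n) (Suc n) - matrix_exp (A + B)) \<longlonglongrightarrow> 0"
    by (rule Lim_null_comparison[OF eventuallyI])
  then have "(\<lambda>n. mpow (P n) (Suc n)) \<longlonglongrightarrow> matrix_exp (A + B)"
    by (simp only: LIM_zero_iff)
  then have "matrix_exp (A + B) \<in> G"
    by (rule closed_sequentially[OF closed, rotated]) (rule mpow_closed[OF P])
  then show "matrix_exp (t *\<^sub>R (X + Y)) \<in> G"
    by (simp add: A_def B_def scaleR_add_right)
qed

lemma subspace_lie_algebra: "subspace (lie_algebra G)"
proof (rule subspaceI)
  show "0 \<in> lie_algebra G"
    by (simp add: lie_algebra_def subgroupD)
  show "c *\<^sub>R X \<in> lie_algebra G" if "X \<in> lie_algebra G" for c X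
    using lie_algebraD[OF that] by (simp add: lie_algebra_def)
qed (rule lie_algebra_add)

lemma lie_algebra_conj:
  assumes g: "g \<in> G" and X: "X \<in> lie_algebra G"
  shows "g ** X ** transpose g \<in> lie_algebra G"
  unfolding lie_algebra_def
proof (intro CollectI allI)
  fix s :: real
  have "matrix_exp (s *\<^sub>R (g ** X ** transpose g)) = matrix_exp (g ** (s *\<^sub>R X) ** transpose g)"
    by (simp add: matrix_mult.scaleR_left matrix_mult.scaleR_right)
  also have "\<dots> = g ** matrix_exp (s *\<^sub>R X) ** transpose g"
    using subgroupD(1)[OF g] by (intro matrix_exp_conj) (auto simp: orthogonal_matrix_def)
  also have "\<dots> \<in> G"
    by (intro subgroupD g lie_algebraD X)
  finally show "matrix_exp (s *\<^sub>R (g ** X ** transpose g)) \<in> G" .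
qed

text \<open>\<open>[X, Y]\<close> is the derivative at \<open>0\<close> of \<open>exp (sX) Y exp (-sX)\<close>, which stays in the algebra.\<close>

lemma lie_algebra_commutator:
  assumes X: "X \<in> lie_algebra G" and Y: "Y \<in> lie_algebra G"
  shows "commutator X Y \<in> lie_algebra G"
proof -
  have orth: "orthogonal_matrix (matrix_exp (s *\<^sub>R X))" for s
    by (rule subgroupD(1)[OF lie_algebraD[OF X]])
  define F where "F s = matrix_exp (s *\<^sub>R X) ** Y ** matrix_exp (- (s *\<^sub>R X))" for s
  obtain C where C: "\<And>s. \<bar>s\<bar> \<le> 1 \<Longrightarrow> norm (F s - Y - s *\<^sub>R commutator X Y) \<le> C * s\<^sup>2"
    using matrix_exp_conj_approx[OF orth] unfolding F_def by metis
  have F: "F s \<in> lie_algebra G" for s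
    using lie_algebra_conj[OF lie_algebraD[OF X] Y, of s]
    by (simp add: F_def transpose_matrix_exp transpose_scalar lie_algebra_skew[OF X])
  define r where "r n = inverse (real (Suc n))" for n
  define D where "D n = inverse (r n) *\<^sub>R (F (r n) - Y)" for n
  have "norm (D n - commutator X Y) \<le> C * r n" for n
  proof -
    have "r n > 0" "r n \<le> 1"
      by (auto simp: r_def inverse_le_1_iff)
    have "D n - commutator X Y = inverse (r n) *\<^sub>R (F (r n) - Y - r n *\<^sub>R commutator X Y)"
      using \<open>r n > 0\<close> by (simp add: D_def scaleR_diff_right)
    then have "norm (D n - commutator X Y) = inverse (r n) * norm (F (r n) - Y - r n *\<^sub>R commutator X Y)"
      using \<open>r n > 0\<close> by simp
    also have "\<dots> \<le> inverse (r n) * (C * (r n)\<^sup>2)"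
      using \<open>r n > 0\<close> \<open>r n \<le> 1\<close> by (intro mult_left_mono C) auto
    also have "\<dots> = C * r n"
      using \<open>r n > 0\<close> by (simp add: power2_eq_square)
    finally show ?thesis .
  qed
  moreover have "(\<lambda>n. C * r n) \<longlonglongrightarrow> 0"
    unfolding r_def using tendsto_mult_right_zero[OF LIMSEQ_inverse_real_of_nat] by blast
  ultimately have "(\<lambda>n. D n - commutator X Y) \<longlonglongrightarrow> 0"
    by (rule Lim_null_comparison[OF eventuallyI])
  then have lim: "D \<longlonglongrightarrow> commutator X Y"
    by (simp only: LIM_zero_iff)
  have "D n \<in> lie_algebra G" for n
    unfolding D_def by (intro subspace_scale subspace_diff subspace_lie_algebra F Y)
  then show ?thesis
    using closed_sequentially[OF closed_subspace[OF subspace_lie_algebra] _ lim] by blast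
qed

end

section \<open>The Killing form of a semisimple algebra of skew-symmetric matrices\<close>

definition endo_on :: "'a::real_vector set \<Rightarrow> ('a \<Rightarrow> 'a) \<Rightarrow> bool" where
  "endo_on L f \<longleftrightarrow> (\<forall>x\<in>L. f x \<in> L) \<and> (\<forall>x\<in>L. \<forall>y\<in>L. f (x + y) = f x + f y) \<and>
     (\<forall>c. \<forall>x\<in>L. f (c *\<^sub>R x) = c *\<^sub>R f x)"

lemma endo_on_sum:
  assumes "endo_on L f" "subspace L" "finite C" "C \<subseteq> L"
  shows "f (\<Sum>c\<in>C. a c *\<^sub>R c) = (\<Sum>c\<in>C. a c *\<^sub>R f c)"
  using assms(3,4)
proof (induction C rule: finite_induct)
  case empty
  have "f (0 *\<^sub>R 0) = 0 *\<^sub>R f 0"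
    using assms(1,2) subspace_0 unfolding endo_on_def by blast
  then show ?case by simp
next
  case (insert c C)
  then have "c \<in> L" "a c *\<^sub>R c \<in> L" "(\<Sum>c\<in>C. a c *\<^sub>R c) \<in> L"
    using assms(2) by (auto intro!: subspace_sum subspace_scale)
  then show ?case
    using insert assms(1) by (simp add: endo_on_def)
qed

lemma endo_on_comp: "endo_on L f \<Longrightarrow> endo_on L g \<Longrightarrow> endo_on L (\<lambda>x. f (g x))"
  by (simp add: endo_on_def)

definition trace_on :: "'a::real_inner set \<Rightarrow> ('a \<Rightarrow> 'a) \<Rightarrow> real" where
  "trace_on B f = (\<Sum>b\<in>B. f b \<bullet> b)"

lemma trace_on_commute:
  fixes B :: "'a::euclidean_space set"
  assumes B: "pairwise orthogonal B" "\<And>x. x \<in> B \<Longrightarrow> norm x = 1" "finite B" "span B = L"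
    and S: "endo_on L S" and T: "endo_on L T"
  shows "trace_on B (\<lambda>x. S (T x)) = trace_on B (\<lambda>x. T (S x))"
proof -
  have BL: "B \<subseteq> L" and L: "subspace L"
    using B(4) span_superset subspace_span by blast+
  have expand: "trace_on B (\<lambda>x. f (g x)) = (\<Sum>b\<in>B. \<Sum>c\<in>B. (g b \<bullet> c) * (f c \<bullet> b))"
    if f: "endo_on L f" and g: "endo_on L g" for f g
    unfolding trace_on_def
  proof (rule sum.cong[OF refl])
    fix b assume "b \<in> B"
    then have "g b \<in> span B"
      using g BL B(4) by (auto simp: endo_on_def)
    then have "g b = (\<Sum>c\<in>B. (g b \<bullet> c) *\<^sub>R c)"
      using orthonormal_basis_expand[OF B(1,2) _ B(3)] by simp
    then have "f (g b) = (\<Sum>c\<in>B. (g b \<bullet> c) *\<^sub>R f c)"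
      using endo_on_sum[OF f L B(3) BL, of "\<lambda>c. g b \<bullet> c"] by simp
    then show "f (g b) \<bullet> b = (\<Sum>c\<in>B. (g b \<bullet> c) * (f c \<bullet> b))"
      by (simp add: inner_sum_left)
  qed
  show ?thesis
    unfolding expand[OF S T] expand[OF T S] by (subst sum.swap) (simp add: mult.commute)
qed

lemma commutator_add_left: "commutator (X + Y) Z = commutator X Z + commutator Y Z"
  and commutator_add_right: "commutator X (Y + Z) = commutator X Y + commutator X Z"
  and commutator_scaleR_left: "commutator (c *\<^sub>R X) Y = c *\<^sub>R commutator X Y"
  and commutator_scaleR_right: "commutator X (c *\<^sub>R Y) = c *\<^sub>R commutator X Y"
  by (simp_all add: commutator_def matrix_mult.add_left matrix_mult.add_right
      matrix_mult.scaleR_left matrix_mult.scaleR_right scaleR_diff_right)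

lemma commutator_zero: "commutator 0 X = 0" "commutator X 0 = 0"
  by (simp_all add: commutator_def matrix_mult.zero_left matrix_mult.zero_right)

lemma commutator_conj:
  fixes g :: "real^'n^'n"
  assumes "orthogonal_matrix g"
  shows "commutator (g ** X ** transpose g) (g ** Y ** transpose g) = g ** commutator X Y ** transpose g"
proof -
  have "(g ** U ** transpose g) ** (g ** V ** transpose g) = g ** (U ** V) ** transpose g" for U V
  proof -
    have "(g ** U ** transpose g) ** (g ** V ** transpose g) = g ** U ** (transpose g ** g) ** V ** transpose g"
      by (simp only: matrix_mul_assoc)
    moreover have "transpose g ** g = mat 1"
      using assms by (simp add: orthogonal_matrix_def)
    ultimately show ?thesis
      by (simp add: matrix_mul_assoc)
  qed
  then show ?thesis
    by (simp add: commutator_def matrix_mult.diff_left matrix_mult.diff_right)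
qed

lemma inner_commutator_skew:
  fixes X Y Z :: "real^'n^'n"
  assumes "transpose X = - X"
  shows "commutator X Y \<bullet> Z = - (Y \<bullet> commutator X Z)"
  using inner_matrix_mult_left[of X Y Z] inner_matrix_mult_right[of Y X Z] assms
  by (simp add: commutator_def inner_diff_left inner_diff_right matrix_mult.minus_left
      matrix_mult.minus_right)

locale skew_semisimple =
  fixes L :: "(real^'n^'n) set"
  assumes subspace: "subspace L"
    and commutator_closed: "\<And>X Y. X \<in> L \<Longrightarrow> Y \<in> L \<Longrightarrow> commutator X Y \<in> L"
    and skew: "\<And>X. X \<in> L \<Longrightarrow> transpose X = - X"
    and semisimple: "lie_semisimple L"
begin

definition onb :: "(real^'n^'n) set" where
  "onb = (SOME B. pairwise orthogonal B \<and> (\<forall>x\<in>B. norm x = 1) \<and> finite B \<and> span B = L)"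

lemma onb: "pairwise orthogonal onb" "\<And>x. x \<in> onb \<Longrightarrow> norm x = 1" "finite onb" "span onb = L"
proof -
  have "\<exists>B. pairwise orthogonal B \<and> (\<forall>x\<in>B. norm x = 1) \<and> finite B \<and> span B = L"
    using orthonormal_basis_subspace[OF subspace] independent_imp_finite by metis
  from someI_ex[OF this]
  show "pairwise orthogonal onb" "\<And>x. x \<in> onb \<Longrightarrow> norm x = 1" "finite onb" "span onb = L"
    by (auto simp: onb_def)
qed

definition killing :: "real^'n^'n \<Rightarrow> real^'n^'n \<Rightarrow> real" where
  "killing X Y = trace_on onb (\<lambda>Z. commutator X (commutator Y Z))"

lemma endo_on_ad: "X \<in> L \<Longrightarrow> endo_on L (commutator X)"
  by (simp add: endo_on_def commutator_closed commutator_add_right commutator_scaleR_right)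

lemma killing_add_right: "killing X (Y + Z) = killing X Y + killing X Z"
  by (simp add: killing_def trace_on_def commutator_add_left commutator_add_right inner_add_left
      sum.distrib)

lemma killing_minus_right: "killing X (- Y) = - killing X Y"
  using commutator_scaleR_left[of "-1" Y] commutator_scaleR_right[of X "-1"]
  by (simp add: killing_def trace_on_def sum_negf)

lemma killing_automorphism:
  assumes \<phi>: "endo_on L \<phi>" and \<psi>: "endo_on L \<psi>"
    and inv: "\<And>X. X \<in> L \<Longrightarrow> \<phi> (\<psi> X) = X" "\<And>X. X \<in> L \<Longrightarrow> \<psi> (\<phi> X) = X"
    and hom: "\<And>X Y. X \<in> L \<Longrightarrow> Y \<in> L \<Longrightarrow> \<phi> (commutator X Y) = commutator (\<phi> X) (\<phi> Y)"
    and X: "X \<in> L" and Y: "Y \<in> L"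
  shows "killing (\<phi> X) (\<phi> Y) = killing X Y"
proof -
  have onbL: "onb \<subseteq> L"
    using onb(4) span_superset by blast
  have T: "endo_on L (\<lambda>Z. commutator X (commutator Y Z))"
    by (rule endo_on_comp[OF endo_on_ad[OF X] endo_on_ad[OF Y]])
  have \<phi>L: "\<phi> Z \<in> L" and \<psi>L: "\<psi> Z \<in> L" if "Z \<in> L" for Z
    using \<phi> \<psi> that by (auto simp: endo_on_def)
  have "commutator (\<phi> X) (commutator (\<phi> Y) Z) = \<phi> (commutator X (commutator Y (\<psi> Z)))"
    if "Z \<in> L" for Z
    using that by (simp add: hom X Y \<psi>L commutator_closed inv)
  then have "killing (\<phi> X) (\<phi> Y) = trace_on onb (\<lambda>Z. \<phi> (commutator X (commutator Y (\<psi> Z))))"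
    unfolding killing_def trace_on_def using onbL by (intro sum.cong) auto
  also have "\<dots> = trace_on onb (\<lambda>Z. commutator X (commutator Y (\<psi> (\<phi> Z))))"
    by (rule trace_on_commute[OF onb \<phi> endo_on_comp[OF T \<psi>]])
  also have "\<dots> = killing X Y"
    unfolding killing_def trace_on_def using onbL by (intro sum.cong) (auto simp: inv)
  finally show ?thesis .
qed

text \<open>Since \<open>ad X\<close> is skew, \<open>killing X X = - \<parallel>ad X\<parallel>\<^sup>2\<close>, so \<open>X\<close> is central; the centre is an abelian
  ideal.\<close>

lemma killing_definite:
  assumes X: "X \<in> L" and "killing X X = 0"
  shows "X = 0"
proof -
  let ?Z = "{X \<in> L. \<forall>Y\<in>L. commutator X Y = 0}"
  have "killing X X = - (\<Sum>b\<in>onb. (norm (commutator X b))\<^sup>2)"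
    by (simp add: killing_def trace_on_def inner_commutator_skew[OF skew[OF X]]
        power2_norm_eq_inner sum_negf)
  then have basis: "\<forall>b\<in>onb. commutator X b = 0"
    using assms(2) onb(3) by (simp add: sum_nonneg_eq_0_iff)
  have "commutator X Y = 0" if "Y \<in> span onb" for Y
    using that
    by (induction rule: span_induct_alt)
       (simp_all add: basis commutator_zero commutator_add_right commutator_scaleR_right)
  then have "X \<in> ?Z"
    using X onb(4) by simp
  moreover have "lie_ideal ?Z L"
  proof -
    have "subspace ?Z"
      using subspace
      by (auto simp: subspace_def commutator_add_left commutator_scaleR_left commutator_zero)
    moreover have "commutator U V = 0" if "U \<in> L" "V \<in> ?Z" for U V
    proof -
      have "commutator U V = - commutator V U"
        by (simp add: commutator_def)
      then show ?thesis
        using that by simp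
    qed
    ultimately show ?thesis
      by (auto simp: lie_ideal_def subspace_0[OF subspace] commutator_closed commutator_zero)
  qed
  moreover have "lie_solvable ?Z"
  proof -
    have "0 \<in> ?Z"
      using \<open>lie_ideal ?Z L\<close> subspace_0 unfolding lie_ideal_def by blast
    then have "{commutator U V | U V. U \<in> ?Z \<and> V \<in> ?Z} = {0}"
      by (auto intro!: exI[of _ 0])
    then have "(derived_algebra ^^ 1) ?Z = {0}"
      by (simp add: derived_algebra_def)
    then show ?thesis
      unfolding lie_solvable_def by blast
  qed
  ultimately show ?thesis
    using semisimple unfolding lie_semisimple_def by blast
qed

lemma cartan_complement_invariant:
  assumes cartan: "cartan_decomposition L \<tt> \<pp>"
    and k: "orthogonal_matrix k"
    and kL: "\<And>X. X \<in> L \<Longrightarrow> k ** X ** transpose k \<in> L"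
    and kL': "\<And>X. X \<in> L \<Longrightarrow> transpose k ** X ** k \<in> L"
    and kt: "\<And>X. X \<in> \<tt> \<Longrightarrow> transpose k ** X ** k \<in> \<tt>"
    and v: "v \<in> \<pp>"
  shows "k ** v ** transpose k \<in> \<pp>"
proof -
  obtain \<theta> where \<theta>: "involutive_automorphism L \<theta>"
    and \<tt>: "\<tt> = {X \<in> L. \<theta> X = X}" and \<pp>: "\<pp> = {X \<in> L. \<theta> X = - X}"
    using cartan unfolding cartan_decomposition_def by blast
  have \<theta>_endo: "endo_on L \<theta>"
    using \<theta> by (simp add: involutive_automorphism_def endo_on_def)
  have \<theta>_L: "\<theta> X \<in> L" and \<theta>_inv: "\<theta> (\<theta> X) = X" if "X \<in> L" for X
    using \<theta> that by (auto simp: involutive_automorphism_def)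
  have \<theta>_hom: "\<theta> (commutator X Y) = commutator (\<theta> X) (\<theta> Y)" if "X \<in> L" "Y \<in> L" for X Y
    using \<theta> that by (auto simp: involutive_automorphism_def)
  have orth: "killing X Y = 0" if "X \<in> \<tt>" "Y \<in> \<pp>" for X Y
  proof -
    have "killing (\<theta> X) (\<theta> Y) = killing X Y"
      using that by (intro killing_automorphism[OF \<theta>_endo \<theta>_endo]) (auto simp: \<tt> \<pp> \<theta>_inv \<theta>_hom)
    then show ?thesis
      using that by (simp add: \<tt> \<pp> killing_minus_right)
  qed
  let ?\<phi> = "\<lambda>X. k ** X ** transpose k" and ?\<psi> = "\<lambda>X. transpose k ** X ** k"
  have \<phi>\<psi>: "?\<phi> (?\<psi> X) = X" and \<psi>\<phi>: "?\<psi> (?\<phi> X) = X" for X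
  proof -
    have "?\<phi> (?\<psi> X) = (k ** transpose k) ** X ** (k ** transpose k)"
      "?\<psi> (?\<phi> X) = (transpose k ** k) ** X ** (transpose k ** k)"
      by (simp_all only: matrix_mul_assoc)
    then show "?\<phi> (?\<psi> X) = X" "?\<psi> (?\<phi> X) = X"
      using k by (simp_all add: orthogonal_matrix_def)
  qed
  have endo: "endo_on L ?\<phi>" "endo_on L ?\<psi>"
    by (simp_all add: endo_on_def kL kL' matrix_mult.add_left matrix_mult.add_right
        matrix_mult.scaleR_left matrix_mult.scaleR_right)
  let ?u = "?\<phi> v"
  have "v \<in> L"
    using v by (simp add: \<pp>)
  then have uL: "?u \<in> L"
    by (rule kL)
  define w where "w = (1 / 2) *\<^sub>R (?u + \<theta> ?u)"
  have wL: "w \<in> L"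
    unfolding w_def by (intro subspace_scale subspace_add subspace uL \<theta>_L)
  have "\<theta> w = (1 / 2) *\<^sub>R (\<theta> ?u + \<theta> (\<theta> ?u))"
    using \<theta>_endo subspace_add[OF subspace uL \<theta>_L[OF uL]] uL \<theta>_L[OF uL]
    unfolding w_def endo_on_def by metis
  then have \<theta>w: "\<theta> w = w"
    by (simp add: w_def \<theta>_inv uL add.commute)
  then have wt: "w \<in> \<tt>"
    by (simp add: \<tt> wL)
  have negL: "- w \<in> L"
    by (rule subspace_neg[OF subspace wL])
  have \<theta>negw: "\<theta> (- w) = - w"
    using \<theta>_endo wL \<theta>w unfolding endo_on_def by (metis scaleR_minus1_left)
  have \<theta>u: "\<theta> (?u + - w) = \<theta> ?u + - w"
  proof -
    have "\<theta> (?u + - w) = \<theta> ?u + \<theta> (- w)"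
      using \<theta>_endo uL negL unfolding endo_on_def by blast
    then show ?thesis
      unfolding \<theta>negw .
  qed
  have "w + w = ?u + \<theta> ?u"
    by (simp add: w_def flip: scaleR_add_left)
  then have "\<theta> (?u + - w) = - (?u + - w)"
    unfolding \<theta>u by (simp add: algebra_simps)
  then have rest: "?u + - w \<in> \<pp>"
    using subspace_add[OF subspace uL negL] by (simp add: \<pp>)
  have "killing w ?u = killing (?\<phi> (?\<psi> w)) (?\<phi> v)"
    by (simp only: \<phi>\<psi>)
  also have "\<dots> = killing (?\<psi> w) v"
    by (rule killing_automorphism[where \<phi> = ?\<phi> and \<psi> = ?\<psi>, OF endo \<phi>\<psi> \<psi>\<phi> commutator_conj[OF k, symmetric] kL'[OF wL] \<open>v \<in> L\<close>])
  also have "\<dots> = 0"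
    by (rule orth[OF kt[OF wt] v])
  finally have "killing w (w + (?u + - w)) = 0"
    by simp
  then have "killing w w = 0"
    unfolding killing_add_right[of w w] orth[OF wt rest] by simp
  then have "w = 0"
    by (rule killing_definite[OF wL])
  then show ?thesis
    using rest by simp
qed

end

section \<open>The maps \<open>Psi\<close>\<close>

lemma Ad_orthogonal: "orthogonal_matrix k \<Longrightarrow> Ad k v = k ** v ** transpose k"
  by (simp add: Ad_def matrix_inv_orthogonal)

lemma Psi_mult_approx:
  fixes k1 k2 v1 v2 :: "real^'n^'n"
  assumes k1: "orthogonal_matrix k1" and k2: "orthogonal_matrix k2"
  shows "\<exists>C. \<forall>lam\<ge>1. norm (Psi lam (k1 ** k2, v1 + Ad k1 v2) - Psi lam (k1, v1) ** Psi lam (k2, v2))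
    \<le> C / lam\<^sup>2"
proof -
  let ?w = "k1 ** v2 ** transpose k1"
  obtain C where C: "\<And>s. \<bar>s\<bar> \<le> 1 \<Longrightarrow>
      norm (matrix_exp (s *\<^sub>R (v1 + ?w)) - matrix_exp (s *\<^sub>R v1) ** matrix_exp (s *\<^sub>R ?w)) \<le> C * s\<^sup>2"
    using matrix_exp_add_approx by metis
  have tk: "transpose k1 ** k1 = mat 1" "k1 ** transpose k1 = mat 1"
    using k1 by (simp_all add: orthogonal_matrix_def)
  have "norm (Psi lam (k1 ** k2, v1 + Ad k1 v2) - Psi lam (k1, v1) ** Psi lam (k2, v2)) \<le> C / lam\<^sup>2"
    if "lam \<ge> 1" for lam
  proof -
    define s where "s = 1 / lam"
    have "matrix_exp (s *\<^sub>R ?w) = k1 ** matrix_exp (s *\<^sub>R v2) ** transpose k1"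
      using matrix_exp_conj[OF tk(2,1), of "s *\<^sub>R v2"]
      by (simp add: matrix_mult.scaleR_left matrix_mult.scaleR_right)
    then have "matrix_exp (s *\<^sub>R ?w) ** k1 = k1 ** matrix_exp (s *\<^sub>R v2) ** (transpose k1 ** k1)"
      by (simp only: matrix_mul_assoc)
    then have conj: "matrix_exp (s *\<^sub>R ?w) ** k1 = k1 ** matrix_exp (s *\<^sub>R v2)"
      by (simp add: tk)
    have "Psi lam (k1, v1) ** Psi lam (k2, v2) = matrix_exp (s *\<^sub>R v1) ** (k1 ** matrix_exp (s *\<^sub>R v2)) ** k2"
      by (simp add: Psi_def s_def matrix_mul_assoc)
    also have "\<dots> = matrix_exp (s *\<^sub>R v1) ** matrix_exp (s *\<^sub>R ?w) ** (k1 ** k2)"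
      by (simp only: matrix_mul_assoc flip: conj)
    finally have "Psi lam (k1 ** k2, v1 + Ad k1 v2) - Psi lam (k1, v1) ** Psi lam (k2, v2)
        = (matrix_exp (s *\<^sub>R (v1 + ?w)) - matrix_exp (s *\<^sub>R v1) ** matrix_exp (s *\<^sub>R ?w)) ** (k1 ** k2)"
      by (simp add: Psi_def s_def Ad_orthogonal[OF k1] matrix_mult.diff_left)
    then have "norm (Psi lam (k1 ** k2, v1 + Ad k1 v2) - Psi lam (k1, v1) ** Psi lam (k2, v2))
        = norm (matrix_exp (s *\<^sub>R (v1 + ?w)) - matrix_exp (s *\<^sub>R v1) ** matrix_exp (s *\<^sub>R ?w))"
      using norm_orthogonal_matrix_mult(2)[OF orthogonal_matrix_mul[OF k1 k2]] by simp
    also have "\<dots> \<le> C * s\<^sup>2"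
      using that by (intro C) (simp add: s_def)
    finally show ?thesis
      by (simp add: s_def power_divide)
  qed
  then show ?thesis
    by blast
qed

lemma inv_cartan_motion_group:
  fixes K V :: "(real^'n^'n) set"
  assumes K: "subgroup K orthogonal_group" and "subspace V"
    and Ad_closed: "\<And>k v. k \<in> K \<Longrightarrow> v \<in> V \<Longrightarrow> k ** v ** transpose k \<in> V"
    and k: "k \<in> K" and v: "v \<in> V"
  shows "inv\<^bsub>cartan_motion_group K V\<^esub> (k, v) = (transpose k, - (transpose k ** v ** k))"
proof -
  note K = subgroup_orthogonalD[OF K]
  have tk: "transpose k ** k = mat 1" "k ** transpose k = mat 1"
    using K(1)[OF k] by (simp_all add: orthogonal_matrix_def)
  have inV: "- (transpose k ** v ** k) \<in> V"
    using Ad_closed[OF K(4)[OF k] v] subspace_neg[OF \<open>subspace V\<close>] by simp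
  have cancel: "k ** (transpose k ** v ** k) ** transpose k = v"
  proof -
    have "k ** (transpose k ** v ** k) ** transpose k = (k ** transpose k) ** v ** (k ** transpose k)"
      by (simp only: matrix_mul_assoc)
    then show ?thesis
      by (simp add: tk)
  qed
  show ?thesis
    unfolding m_inv_def
  proof (rule the_equality)
    show "(transpose k, - (transpose k ** v ** k)) \<in> carrier (cartan_motion_group K V) \<and>
        (k, v) \<otimes>\<^bsub>cartan_motion_group K V\<^esub> (transpose k, - (transpose k ** v ** k)) = \<one>\<^bsub>cartan_motion_group K V\<^esub> \<and>
        (transpose k, - (transpose k ** v ** k)) \<otimes>\<^bsub>cartan_motion_group K V\<^esub> (k, v) = \<one>\<^bsub>cartan_motion_group K V\<^esub>"
      using k inV K(4)[OF k]
      by (simp add: cartan_motion_group_def tk Ad_orthogonal K(1) matrix_mult.minus_left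
          matrix_mult.minus_right cancel)
  next
    fix y
    assume y: "y \<in> carrier (cartan_motion_group K V) \<and>
        (k, v) \<otimes>\<^bsub>cartan_motion_group K V\<^esub> y = \<one>\<^bsub>cartan_motion_group K V\<^esub> \<and>
        y \<otimes>\<^bsub>cartan_motion_group K V\<^esub> (k, v) = \<one>\<^bsub>cartan_motion_group K V\<^esub>"
    obtain l u where lu: "y = (l, u)"
      by (cases y)
    have "l \<in> K" "l ** k = mat 1" "u + l ** v ** transpose l = 0"
      using y by (auto simp: lu cartan_motion_group_def Ad_orthogonal K(1))
    moreover from this have "l = transpose k"
      using tk by (metis matrix_mul_assoc matrix_mul_lid matrix_mul_rid)
    ultimately show "y = (transpose k, - (transpose k ** v ** k))"
      by (simp add: lu eq_neg_iff_add_eq_0)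
  qed
qed

lemma Psi_inverse:
  assumes k: "orthogonal_matrix k" and v: "transpose v = - v"
  shows "Psi lam (transpose k, - (transpose k ** v ** k)) = matrix_inv (Psi lam (k, v))"
proof -
  have tk: "transpose k ** k = mat 1" "k ** transpose k = mat 1"
    using k by (simp_all add: orthogonal_matrix_def)
  define w where "w = (1 / lam) *\<^sub>R v"
  have w: "transpose w = - w"
    by (simp add: w_def transpose_scalar v)
  have "Psi lam (transpose k, - (transpose k ** v ** k)) = matrix_exp (transpose k ** (- w) ** k) ** transpose k"
    by (simp add: Psi_def w_def matrix_mult.minus_left matrix_mult.minus_right
        matrix_mult.scaleR_left matrix_mult.scaleR_right)
  also have "\<dots> = transpose k ** matrix_exp (- w) ** (k ** transpose k)"
    by (simp only: matrix_exp_conj[OF tk] matrix_mul_assoc)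
  also have "\<dots> = transpose (matrix_exp w ** k)"
    by (simp add: tk matrix_transpose_mul transpose_matrix_exp w)
  also have "\<dots> = matrix_inv (Psi lam (k, v))"
    using matrix_inv_orthogonal[OF orthogonal_matrix_mul[OF orthogonal_matrix_exp_skew[OF w] k]]
    by (simp add: Psi_def w_def)
  finally show ?thesis .
qed

theorem proposition3p1:
  fixes G K \<tt> \<pp> :: "(real^'n^'n) set"
  assumes "subgroup G orthogonal_group" and "compact G"
    and "lie_semisimple (lie_algebra G)"
    and "cartan_decomposition (lie_algebra G) \<tt> \<pp>"
    and "subgroup K orthogonal_group" and "closed K" and "K \<subseteq> G"
    and "lie_algebra K = \<tt>"
  shows "(\<forall>lam\<ge>1. \<forall>g \<in> carrier (cartan_motion_group K \<pp>).
            Psi lam (inv\<^bsub>cartan_motion_group K \<pp>\<^esub> g) = matrix_inv (Psi lam g)) \<and>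
         (\<forall>k1 v1 k2 v2.
            (k1, v1) \<in> carrier (cartan_motion_group K \<pp>) \<longrightarrow>
            (k2, v2) \<in> carrier (cartan_motion_group K \<pp>) \<longrightarrow>
            (\<exists>C::real. \<forall>lam\<ge>1. norm v1 + norm v2 \<le> lam * 0.59 \<longrightarrow>
               norm (Psi lam ((k1, v1) \<otimes>\<^bsub>cartan_motion_group K \<pp>\<^esub> (k2, v2))
                     - Psi lam (k1, v1) ** Psi lam (k2, v2)) \<le> C / lam\<^sup>2))"
proof (rule conjI)
  interpret G: closed_orthogonal_subgroup G
    by (rule closed_orthogonal_subgroup.intro) (simp_all add: assms compact_imp_closed)
  interpret K: closed_orthogonal_subgroup K
    by (rule closed_orthogonal_subgroup.intro) (simp_all add: assms)
  interpret L: skew_semisimple "lie_algebra G"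
    by unfold_locales
      (simp_all add: assms G.subspace_lie_algebra G.lie_algebra_commutator G.lie_algebra_skew)
  obtain \<theta> where \<theta>: "involutive_automorphism (lie_algebra G) \<theta>"
    and \<pp>: "\<pp> = {X \<in> lie_algebra G. \<theta> X = - X}"
    using assms(4) unfolding cartan_decomposition_def by blast
  have \<pp>_subspace: "subspace \<pp>"
  proof (rule subspaceI)
    have "\<theta> (0 *\<^sub>R 0) = 0 *\<^sub>R \<theta> 0"
      using \<theta> subspace_0[OF L.subspace] unfolding involutive_automorphism_def by blast
    then show "0 \<in> \<pp>"
      by (simp add: \<pp> subspace_0[OF L.subspace])
    show "X + Y \<in> \<pp>" if "X \<in> \<pp>" "Y \<in> \<pp>" for X Y
      using that \<theta> by (simp add: \<pp> involutive_automorphism_def G.lie_algebra_add)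
    show "c *\<^sub>R X \<in> \<pp>" if "X \<in> \<pp>" for c X
      using that \<theta> by (simp add: \<pp> involutive_automorphism_def subspace_scale[OF L.subspace])
  qed
  have \<pp>_Ad: "k ** v ** transpose k \<in> \<pp>" if k: "k \<in> K" and v: "v \<in> \<pp>" for k v
  proof (rule L.cartan_complement_invariant[OF assms(4) K.subgroupD(1)[OF k] _ _ _ v])
    have "k \<in> G" "transpose k \<in> G"
      using k assms(7) G.subgroupD(4) by auto
    then show "k ** X ** transpose k \<in> lie_algebra G" "transpose k ** X ** k \<in> lie_algebra G"
      if "X \<in> lie_algebra G" for X
      using G.lie_algebra_conj[OF _ that, of k] G.lie_algebra_conj[OF _ that, of "transpose k"] by simp_all
    show "transpose k ** X ** k \<in> \<tt>" if "X \<in> \<tt>" for X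
      using K.lie_algebra_conj[OF K.subgroupD(4)[OF k], of X] that by (simp add: assms(8))
  qed
  show "\<forall>lam\<ge>1. \<forall>g \<in> carrier (cartan_motion_group K \<pp>).
      Psi lam (inv\<^bsub>cartan_motion_group K \<pp>\<^esub> g) = matrix_inv (Psi lam g)"
  proof (intro allI impI ballI)
    fix lam :: real and g
    assume "g \<in> carrier (cartan_motion_group K \<pp>)"
    then obtain k v where g: "g = (k, v)" and k: "k \<in> K" and v: "v \<in> \<pp>"
      by (auto simp: cartan_motion_group_def)
    have "inv\<^bsub>cartan_motion_group K \<pp>\<^esub> g = (transpose k, - (transpose k ** v ** k))"
      unfolding g by (rule inv_cartan_motion_group[OF assms(5) \<pp>_subspace _ k v]) (rule \<pp>_Ad)
    moreover have "transpose v = - v"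
      using v by (simp add: \<pp> L.skew)
    ultimately show "Psi lam (inv\<^bsub>cartan_motion_group K \<pp>\<^esub> g) = matrix_inv (Psi lam g)"
      using Psi_inverse[OF K.subgroupD(1)[OF k]] by (simp add: g)
  qed
  show "\<forall>k1 v1 k2 v2.
      (k1, v1) \<in> carrier (cartan_motion_group K \<pp>) \<longrightarrow>
      (k2, v2) \<in> carrier (cartan_motion_group K \<pp>) \<longrightarrow>
      (\<exists>C::real. \<forall>lam\<ge>1. norm v1 + norm v2 \<le> lam * 0.59 \<longrightarrow>
         norm (Psi lam ((k1, v1) \<otimes>\<^bsub>cartan_motion_group K \<pp>\<^esub> (k2, v2))
               - Psi lam (k1, v1) ** Psi lam (k2, v2)) \<le> C / lam\<^sup>2)"
  proof (intro allI impI)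
    fix k1 v1 k2 v2
    assume "(k1, v1) \<in> carrier (cartan_motion_group K \<pp>)" "(k2, v2) \<in> carrier (cartan_motion_group K \<pp>)"
    then have "orthogonal_matrix k1" "orthogonal_matrix k2"
      by (simp_all add: cartan_motion_group_def K.subgroupD)
    from Psi_mult_approx[OF this, of v1 v2]
    show "\<exists>C::real. \<forall>lam\<ge>1. norm v1 + norm v2 \<le> lam * 0.59 \<longrightarrow>
         norm (Psi lam ((k1, v1) \<otimes>\<^bsub>cartan_motion_group K \<pp>\<^esub> (k2, v2))
               - Psi lam (k1, v1) ** Psi lam (k2, v2)) \<le> C / lam\<^sup>2"
      by (auto simp: cartan_motion_group_def)
  qed
qed

end
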